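(* Let $k\ge 2$ be an integer and let $k_1,\dots,k_m$ be the distinct primes in the prime decomposition of $k$. Let $n\ge 1$ and $s\ge 2$ be integers such that $\gcd(n,s)=1$ and $s=k_1^{l_1}\cdots k_m^{l_m}\,p$, where $l_1,\dots,l_m\in\mathbb{N}$ and $p\ge 2$ is an integer with $\gcd(p,k-1)=\gcd(p,k)=1$. Then $n/s$ is a repeating fractional to the base $k$, and, letting $n_{s,T}$ be its repetend to the base $k$ (regarded as a natural number), $$\bar r_k(n_{s,T})\equiv 0 \pmod{k-1}.$$
   Context: $\mathbb{N}=\{0,1,2,\dots\}$. Fix an integer base $k\ge 2$. A rational number $q$ is a terminating fractional to the base $k$ if there is $\rho\in\mathbb{N}$ with $k^{\rho}q\in\mathbb{Z}$, and a repeating fractional to the base $k$ otherwise. Repetend: a positive rational number $t$ that is a repeating fractional to the base $k$ has a base-$k$ expansion $t=\sum_{j\ge 0}a_{P-j}k^{P-j}$ with $P\in\mathbb{N}$, digits $a_i\in\{0,\dots,k-1\}$, infinitely many of which are nonzero (unique up to leading zeros). Its digits after the radix point are eventually periodic: there are $\rho_0\in\mathbb{N}$ and $T\ge 1$ such that $a_{i-T}=a_i$ for all $i\le -\rho_0-1$; take $\rho_0$ (the number of fractional digits preceding the repeating part) and $T$ (the period) minimal. The repetend of $t$ is the block of digits $a_{-\rho_0-1}a_{-\rho_0-2}\cdots a_{-\rho_0-T}$, regarded as the natural number $\sum_{m=0}^{T-1}a_{-\rho_0-1-m}\,k^{T-1-m}$. Digital root: for $n\in\mathbb{N}$ the digital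 sum $d_k(n)$ is the sum of the base-$k$ digits of $n$, and $d_k^{(N)}$ is the $N$-fold composition of $d_k$ with itself ($d_k^{(0)}$ is the identity). The additive persistence is $\mathcal{A}_k(n)=\min\{N\in\mathbb{N}:0\le d_k^{(N)}(n)\le k-1\}$ and the digital root is $r_k(n)=d_k^{(\mathcal{A}_k(n))}(n)\in\{0,\dots,k-1\}$. On natural numbers, $\bar r_k(n)=r_k(n)$. *)

theory Defs
  imports Complex_Main "HOL-Number_Theory.Cong" "HOL-Computational_Algebra.Primes"
begin

definition terminating_fractional :: "nat \<Rightarrow> rat \<Rightarrow> bool" where
  "terminating_fractional k q \<longleftrightarrow> (\<exists>\<rho>::nat. of_nat k ^ \<rho> * q \<in> \<int>)"

definition repeating_fractional :: "nat \<Rightarrow> rat \<Rightarrow> bool" where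
  "repeating_fractional k q \<longleftrightarrow> \<not> terminating_fractional k q"

text \<open>
  \<open>a i\<close> is the digit at the place of weight \<open>k\<close> to the power \<open>i\<close>, so the fractional
  digits are those with \<open>i < 0\<close>. The digits above the leading position \<open>P\<close> are set to \<open>0\<close>;
  this makes \<open>a\<close> independent of the number of leading zeros, hence of \<open>P\<close>.
\<close>

definition base_expansion :: "nat \<Rightarrow> rat \<Rightarrow> nat \<Rightarrow> (int \<Rightarrow> nat) \<Rightarrow> bool" where
  "base_expansion k t P a \<longleftrightarrow>
     (\<forall>i. a i < k) \<and> (\<forall>i > int P. a i = 0) \<and> infinite {i. a i \<noteq> 0} \<and>
     (\<lambda>j. real (a (int P - int j)) * real k powi (int P - int j)) sums of_rat t"

definition expansion_digit :: "nat \<Rightarrow> rat \<Rightarrow> int \<Rightarrow> nat" where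
  "expansion_digit k t = (THE a. \<exists>P. base_expansion k t P a)"

definition periodic_after :: "(int \<Rightarrow> nat) \<Rightarrow> nat \<Rightarrow> nat \<Rightarrow> bool" where
  "periodic_after a \<rho> T \<longleftrightarrow> T \<ge> 1 \<and> (\<forall>i \<le> - int \<rho> - 1. a (i - int T) = a i)"

definition preperiod_length :: "nat \<Rightarrow> rat \<Rightarrow> nat" where
  "preperiod_length k t = (LEAST \<rho>. \<exists>T. periodic_after (expansion_digit k t) \<rho> T)"

definition period_length :: "nat \<Rightarrow> rat \<Rightarrow> nat" where
  "period_length k t =
     (LEAST T. periodic_after (expansion_digit k t) (preperiod_length k t) T)"

definition repetend :: "nat \<Rightarrow> rat \<Rightarrow> nat" where
  "repetend k t =
     (\<Sum>m<period_length k t.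
        expansion_digit k t (- int (preperiod_length k t) - 1 - int m)
          * k ^ (period_length k t - 1 - m))"

text \<open>The guard \<open>k < 2\<close> only serves termination.\<close>

fun digital_sum :: "nat \<Rightarrow> nat \<Rightarrow> nat" where
  "digital_sum k n = (if k < 2 \<or> n = 0 then 0 else n mod k + digital_sum k (n div k))"

declare digital_sum.simps [simp del]

definition additive_persistence :: "nat \<Rightarrow> nat \<Rightarrow> nat" where
  "additive_persistence k n = (LEAST N. (digital_sum k ^^ N) n \<le> k - 1)"

definition digital_root :: "nat \<Rightarrow> nat \<Rightarrow> nat" where
  "digital_root k n = (digital_sum k ^^ additive_persistence k n) n"

end

theory Submission imports Defs begin

text \<open>
  Write \<open>n k\<^sup>j = s A\<^sub>j + x\<^sub>j\<close> with \<open>0 \<le> x\<^sub>j < s\<close>. The fractional digits of \<open>n/s\<close> are those of the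
  long division, \<open>A\<^sub>j\<^sub>+\<^sub>1 = k A\<^sub>j + a\<^sub>-\<^sub>j\<^sub>-\<^sub>1\<close>. Periodicity of the digits after \<open>\<rho>\<close> with period \<open>T\<close>
  forces \<open>x\<close> to agree at \<open>\<rho>\<close> and \<open>\<rho> + T\<close>, so the repetend \<open>R\<close> satisfies
  \<open>n k\<^sup>\<rho> (k\<^sup>T - 1) = s ((k\<^sup>T - 1) A\<^sub>\<rho> + R)\<close>. Hence \<open>k - 1\<close> divides \<open>s R\<close>, and it is coprime to \<open>s\<close>;
  the digital root preserves residues modulo \<open>k - 1\<close>.
\<close>

section \<open>Digital sums modulo \<open>k - 1\<close>\<close>

lemma cong_base_1:
  fixes k :: nat
  assumes "k \<ge> 1"
  shows "[k = 1] (mod (k - 1))"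
  using assms by (simp add: cong_altdef_nat cong_sym_eq)

text \<open>Casting out nines: splitting off the last digit leaves \<open>k * (n div k)\<close>,
  which agrees with \<open>n div k\<close> because \<open>k\<close> is 1 modulo
  \<open>k - 1\<close>.\<close>

lemma digital_sum_cong:
  assumes "k \<ge> 2"
  shows "[digital_sum k n = n] (mod (k - 1))"
proof (induction n rule: less_induct)
  case (less n)
  show ?case
  proof (cases "n = 0")
    case True
    then show ?thesis by (simp add: digital_sum.simps)
  next
    case False
    then have "[digital_sum k (n div k) = n div k] (mod (k - 1))"
      using assms by (intro less) simp
    moreover have "[1 * (n div k) = k * (n div k)] (mod (k - 1))"
      using assms by (intro cong_mult cong_refl cong_sym[OF cong_base_1]) simp
    ultimately have "[digital_sum k (n div k) = k * (n div k)] (mod (k - 1))"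
      by (metis cong_trans mult_1)
    then have "[n mod k + digital_sum k (n div k) = n mod k + k * (n div k)] (mod (k - 1))"
      by (intro cong_add cong_refl)
    then show ?thesis
      using False assms by (simp add: digital_sum.simps[of k n])
  qed
qed

text \<open>Every iterate of the digital sum keeps the residue, in particular the one selected by
  the additive persistence.\<close>

lemma digital_root_cong:
  assumes "k \<ge> 2"
  shows "[digital_root k n = n] (mod (k - 1))"
proof -
  have "[(digital_sum k ^^ N) n = n] (mod (k - 1))" for N
  proof (induction N)
    case (Suc N)
    then show ?case
      using cong_trans[OF digital_sum_cong[OF assms]] by simp
  qed simp
  then show ?thesis by (simp add: digital_root_def)
qed

section \<open>Existence and uniqueness of the expansion\<close>

text \<open>The explicit candidate behind the \<open>THE\<close> in \<open>expansion_digit\<close>: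
  move the radix point so that place \<open>i\<close> becomes the units place, then read off the
  last digit of the integer part.\<close>

definition floor_digit :: "nat \<Rightarrow> real \<Rightarrow> int \<Rightarrow> nat" where
  "floor_digit k x i = nat (\<lfloor>x * real k powi (- i)\<rfloor> mod int k)"

lemma floor_digit_less: "k \<ge> 2 \<Longrightarrow> floor_digit k x i < k"
  by (simp add: floor_digit_def nat_less_iff)

text \<open>Moving the radix point one place left drops the last digit of the integer part, since
  the floor of \<open>y / k\<close> is the floor of \<open>y\<close> divided by \<open>k\<close>
  with remainder.\<close>

lemma floor_shift:
  assumes "k \<ge> 2"
  shows "\<lfloor>x * real k powi (- i)\<rfloor> = int k * \<lfloor>x * real k powi (- i - 1)\<rfloor> + int (floor_digit k x i)"
proof -
  have "x * real k powi (- i - 1) = (x * real k powi (- i)) / real_of_int (int k)"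
    using assms by (simp add: power_int_diff)
  then have "\<lfloor>x * real k powi (- i - 1)\<rfloor> = \<lfloor>x * real k powi (- i)\<rfloor> div int k"
    by (metis floor_divide_real_eq_div of_nat_0_le_iff)
  then show ?thesis
    using assms by (simp add: floor_digit_def)
qed

text \<open>For \<open>i \<ge> 0\<close> an integer value would contradict the definition directly;
  for negative \<open>i\<close> it would make \<open>t\<close> itself an integer, which terminates
  with exponent 0.\<close>

lemma repeating_not_int:
  assumes "repeating_fractional k t" "k \<ge> 2"
  shows "of_rat t * real k powi i \<notin> \<int>"
proof
  assume "of_rat t * real k powi i \<in> \<int>"
  then obtain z where z: "of_rat t * real k powi i = of_int z"
    by (auto elim: Ints_cases)
  have "\<exists>\<rho>::nat. of_nat k ^ \<rho> * t \<in> \<int>"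
  proof (cases "i \<ge> 0")
    case True
    then obtain m where m: "i = int m" by (metis nonneg_int_cases)
    have "(of_rat (of_nat k ^ m * t) :: real) = of_rat (of_int z)"
      using z by (simp add: m of_rat_mult of_rat_power mult.commute)
    then have "of_nat k ^ m * t = of_int z" by (simp only: of_rat_eq_iff)
    then show ?thesis by (metis Ints_of_int)
  next
    case False
    then obtain m where m: "i = - int m" by (metis int_cases2 of_nat_0_le_iff)
    have "(of_rat t :: real) = of_rat (of_int (z * int k ^ m))"
      using z assms(2)
      by (simp add: m power_int_minus field_simps of_rat_mult of_rat_power)
    then have "of_nat k ^ 0 * t = of_int (z * int k ^ m)" by (simp only: of_rat_eq_iff) simp
    then show ?thesis by (metis Ints_of_int)
  qed
  then show False
    using assms(1) by (simp add: repeating_fractional_def terminating_fractional_def)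
qed

text \<open>Iterating \<open>floor_shift\<close> from a vanishing integer part: the partial sum is
  \<open>x\<close> truncated after its first \<open>m\<close> digits from place \<open>P\<close>
  on.\<close>

lemma floor_digit_partial_sum:
  assumes "k \<ge> 2" and "\<lfloor>x * real k powi (- int P - 1)\<rfloor> = 0"
  shows "(\<Sum>j<m. real (floor_digit k x (int P - int j)) * real k powi (int P - int j)) =
         of_int \<lfloor>x * real k powi (int m - int P - 1)\<rfloor> * real k powi (int P + 1 - int m)"
proof (induction m)
  case 0
  then show ?case using assms by simp
next
  case (Suc m)
  have *: "\<lfloor>x * real k powi (int m - int P)\<rfloor> =
      int k * \<lfloor>x * real k powi (int m - int P - 1)\<rfloor> + int (floor_digit k x (int P - int m))"
    using floor_shift[OF assms(1), of x "int P - int m"] by simp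
  have **: "real k powi (int P + 1 - int m) = real k * real k powi (int P - int m)"
    using assms(1) power_int_add_1[of "real k" "int P - int m"]
    by (simp add: algebra_simps)
  have e: "int (Suc m) - int P - 1 = int m - int P" "int P + 1 - int (Suc m) = int P - int m"
    by simp_all
  show ?case
    unfolding e sum.lessThan_Suc Suc * ** by (simp add: distrib_right)
qed

text \<open>Each truncation misses \<open>x\<close> by at most one unit of its last place, and these
  units tend to 0. With finitely many nonzero digits, \<open>x\<close> would equal a truncation, so
  some power of \<open>k\<close> times \<open>x\<close> would be an integer.\<close>

lemma base_expansion_floor_digit:
  assumes "k \<ge> 2" "t > 0" "repeating_fractional k t"
  shows "\<exists>P. base_expansion k t P (floor_digit k (of_rat t))"
proof -
  define x :: real where "x = of_rat t"
  have x: "x > 0" using assms by (simp add: x_def)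
  have k1: "real k > 1" using assms by simp
  obtain P where "x < real k ^ P" using real_arch_pow[OF k1] by blast
  \<comment> \<open>\<open>k ^ Suc P\<close> is the weight of the first place above
    \<open>P\<close>; with \<open>x\<close> below it, all integer parts at places above
    \<open>P\<close> vanish.\<close>
  also have "\<dots> \<le> real k ^ Suc P" using k1 by (intro power_increasing) auto
  finally have P: "x < real k ^ Suc P" .
  have eq: "real k powi (- int P - 1) = 1 / real k ^ Suc P"
  proof -
    have e: "- int P - 1 = - int (Suc P)" by simp
    show ?thesis unfolding e by (simp only: power_int_minus power_int_of_nat inverse_eq_divide)
  qed
  have lead: "x * real k powi (- i) < 1 \<and> 0 < x * real k powi (- i)" if "i > int P" for i
  proof -
    have "real k powi (- i) \<le> real k powi (- int P - 1)"
      using that k1 by (intro power_int_increasing) auto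
    then have "x * real k powi (- i) \<le> x / real k ^ Suc P"
      using x mult_left_mono[of "real k powi (- i)" "1 / real k ^ Suc P" x] unfolding eq
      by simp
    also have "\<dots> < 1" using P k1 by (subst divide_less_eq) auto
    finally show ?thesis using x k1 by simp
  qed
  have fl0: "\<lfloor>x * real k powi (- i)\<rfloor> = 0" if "i > int P" for i
    using lead[OF that] by (simp add: floor_eq_iff)
  have f0: "\<lfloor>x * real k powi (- int P - 1)\<rfloor> = 0"
    using fl0[of "int P + 1"] by simp
  define S where "S m = (\<Sum>j<m. real (floor_digit k x (int P - int j)) * real k powi (int P - int j))" for m
  have S: "S m = of_int \<lfloor>x * real k powi (int m - int P - 1)\<rfloor> * real k powi (int P + 1 - int m)" for m
    unfolding S_def by (rule floor_digit_partial_sum[OF assms(1) f0])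
  have inv: "real k powi (int m - int P - 1) * real k powi (int P + 1 - int m) = 1" for m
    using k1 by (simp flip: power_int_add)
  have err: "\<bar>S m - x\<bar> \<le> real k ^ Suc P * (1 / real k) ^ m" for m
  proof -
    define w where "w = real k powi (int P + 1 - int m)"
    define y where "y = x * real k powi (int m - int P - 1)"
    have w: "w > 0" using k1 by (simp add: w_def)
    have xy: "x = y * w" using inv[of m] by (simp add: y_def w_def mult.assoc)
    have "S m - x = (of_int \<lfloor>y\<rfloor> - y) * w"
      unfolding S y_def[symmetric] w_def[symmetric] using xy by (simp add: left_diff_distrib)
    then have "\<bar>S m - x\<bar> = \<bar>of_int \<lfloor>y\<rfloor> - y\<bar> * w" using w by (simp add: abs_mult)
    also have "\<dots> \<le> 1 * w" using w by (intro mult_right_mono) linarith+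
    also have "w = real k ^ Suc P * (1 / real k) ^ m"
    proof -
      have e: "int P + 1 - int m = int (Suc P) - int m" by simp
      show ?thesis unfolding w_def e using k1
        by (simp add: power_int_diff power_one_over del: of_nat_Suc power_Suc) 
    qed
    finally show ?thesis by simp
  qed
  have "(\<lambda>m. real k ^ Suc P * (1 / real k) ^ m) \<longlonglongrightarrow> 0"
    using k1 by (intro tendsto_mult_right_zero LIMSEQ_power_zero) simp
  then have "(\<lambda>m. S m - x) \<longlonglongrightarrow> 0"
  proof (rule tendsto_0_le[where K = 1], intro always_eventually allI)
    fix m
    have "norm (S m - x) \<le> real k ^ Suc P * (1 / real k) ^ m"
      using err[of m] by (simp only: real_norm_def)
    also have "\<dots> \<le> norm (real k ^ Suc P * (1 / real k) ^ m)"
      unfolding real_norm_def by (rule abs_ge_self)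
    finally show "norm (S m - x) \<le> norm (real k ^ Suc P * (1 / real k) ^ m) * 1"
      by (simp only: mult_1_right)
  qed
  then have "S \<longlonglongrightarrow> x" by (simp add: LIM_zero_iff)
  then have sums: "(\<lambda>j. real (floor_digit k x (int P - int j)) * real k powi (int P - int j)) sums x"
    unfolding sums_def S_def[symmetric, abs_def] .
  have "infinite {i. floor_digit k x i \<noteq> 0}"
  proof
    assume "finite {i. floor_digit k x i \<noteq> 0}"
    \<comment> \<open>Passes from places to summation indices. Places above \<open>P\<close> all go
      to 0, which is harmless since only a bound \<open>M\<close> is extracted.\<close>
    then have "finite ((\<lambda>i. nat (int P - i)) ` {i. floor_digit k x i \<noteq> 0})" by simp
    then obtain M where M: "\<And>i. floor_digit k x i \<noteq> 0 \<Longrightarrow> nat (int P - i) < M"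
      unfolding finite_nat_set_iff_bounded by blast
    have "floor_digit k x (int P - int j) = 0" if "j \<notin> {..<M}" for j
      using M[of "int P - int j"] that by fastforce
    then have "(\<lambda>j. real (floor_digit k x (int P - int j)) * real k powi (int P - int j)) sums S M"
      unfolding S_def by (intro sums_finite) auto
    then have xS: "x = S M" using sums sums_unique2 by blast
    have cancel: "x * v = c" if "x = c * w" "v * w = 1" for v w c :: real
      using that by algebra
    have "x * real k powi (int M - int P - 1) = of_int \<lfloor>x * real k powi (int M - int P - 1)\<rfloor>"
      using xS S[of M] by (intro cancel[OF _ inv]) (rule trans)
    then show False
      using repeating_not_int[OF assms(3,1)] unfolding x_def by (metis Ints_of_int)
  qed
  then have "base_expansion k t P (floor_digit k x)"
    unfolding base_expansion_def using sums floor_digit_less[OF assms(1)] fl0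
    by (simp add: x_def floor_digit_def)
  then show ?thesis by (auto simp: x_def)
qed

text \<open>The leading \<open>m\<close> digits spell an integer, and the remaining tail is
  nonnegative and strictly less than one unit of the last place. So that integer is the floor of the
  shifted \<open>x\<close>, and its last digit is the one computed by
  \<open>floor_digit\<close>.\<close>

lemma base_expansion_unique:
  assumes "k \<ge> 2" "repeating_fractional k t" "base_expansion k t P b"
  shows "b = floor_digit k (of_rat t)"
proof -
  define x :: real where "x = of_rat t"
  have k1: "real k > 1" using assms by simp
  have bk: "\<And>i. b i < k" and b0: "\<And>i. i > int P \<Longrightarrow> b i = 0"
    and sums: "(\<lambda>j. real (b (int P - int j)) * real k powi (int P - int j)) sums x"
    using assms(3) by (auto simp: base_expansion_def x_def)
  let ?f = "\<lambda>j. real (b (int P - int j)) * real k powi (int P - int j)"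
  \<comment> \<open>\<open>B m\<close> is the integer spelled by the first \<open>m\<close> digits
    from place \<open>P\<close> down, built by Horner's rule.\<close>
  define B where "B = rec_nat 0 (\<lambda>m c. int k * c + int (b (int P - int m)))"
  have B0: "B 0 = 0" and BS: "\<And>m. B (Suc m) = int k * B m + int (b (int P - int m))"
    by (simp_all add: B_def)
  have pw: "real k powi (int P + 1 - int m) = real k * real k powi (int P - int m)" for m
    using k1 power_int_add_1[of "real k" "int P - int m"] by (simp add: algebra_simps)
  have S: "(\<Sum>j<m. ?f j) = of_int (B m) * real k powi (int P + 1 - int m)" for m
  proof (induction m)
    case (Suc m)
    have e: "int P + 1 - int (Suc m) = int P - int m" by simp
    show ?case
      unfolding e sum.lessThan_Suc Suc BS pw by (simp add: distrib_right)
  qed (simp add: B0)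
  have floor: "\<lfloor>x * real k powi (int m - int P - 1)\<rfloor> = B m" for m
  proof -
    define w where "w = real k powi (int P + 1 - int m)"
    have w: "w > 0" using k1 by (simp add: w_def)
    have winv: "real k powi (int m - int P - 1) = inverse w"
      unfolding w_def power_int_minus[symmetric] by (simp add: algebra_simps)
    have tail: "(\<lambda>j. ?f (j + m)) sums (x - of_int (B m) * w)"
      using sums_split_initial_segment[OF sums, of m] by (simp add: S w_def)
    have nonneg: "0 \<le> x - of_int (B m) * w"
      by (rule sums_le[OF _ sums_zero tail]) simp
    \<comment> \<open>The largest possible tail has all digits equal to \<open>k - 1\<close>; its
      geometric series sums to exactly \<open>w\<close>, the weight of the last place kept.\<close>
    have geo: "(\<lambda>j. (real k - 1) * real k powi (int P - int m) * (1 / real k) ^ j) sums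
        ((real k - 1) * real k powi (int P - int m) * (1 / (1 - 1 / real k)))"
      using k1 by (intro sums_mult geometric_sums) simp
    have "(real k - 1) * real k powi (int P - int m) * (1 / (1 - 1 / real k)) = w"
      using k1 unfolding w_def pw by (simp add: field_simps)
    with geo have geo: "(\<lambda>j. (real k - 1) * real k powi (int P - int m) * (1 / real k) ^ j) sums w"
      by simp
    have "x - of_int (B m) * w \<le> w"
    proof (rule sums_le[OF _ tail geo])
      fix j
      have "real k powi (int P - int (j + m)) = real k powi (int P - int m) * (1 / real k) ^ j"
      proof -
        have e: "int P - int (j + m) = (int P - int m) - int j" by simp
        show ?thesis unfolding e using k1
          by (subst power_int_diff) (auto simp: power_divide)
      qed
      moreover have "real (b (int P - int (j + m))) \<le> real k - 1"
        using bk[of "int P - int (j + m)"] by linarith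
      ultimately show "?f (j + m) \<le> (real k - 1) * real k powi (int P - int m) * (1 / real k) ^ j"
        using k1 by (simp add: mult_right_mono mult.assoc)
    qed
    \<comment> \<open>Equality is the expansion ending in digits \<open>k - 1\<close>, which makes \<open>t\<close> terminating.\<close>
    moreover have "x - of_int (B m) * w \<noteq> w"
    proof
      assume "x - of_int (B m) * w = w"
      then have "x * real k powi (int m - int P - 1) = of_int (B m + 1)"
        using w unfolding winv by (simp add: field_simps)
      then show False
        using repeating_not_int[OF assms(2,1), of "int m - int P - 1"] by (simp add: x_def)
    qed
    ultimately have "x - of_int (B m) * w < w" by simp
    then show ?thesis
      using w nonneg unfolding winv by (simp add: floor_eq_iff field_simps)
  qed
  show ?thesis
  proof
    fix i
    show "b i = floor_digit k (of_rat t) i"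
    proof (cases "i \<le> int P")
      case True
      define m where "m = nat (int P - i)"
      have i: "i = int P - int m" using True by (simp add: m_def)
      have "floor_digit k x i = nat (B (Suc m) mod int k)"
        using floor[of "Suc m"] by (simp add: floor_digit_def i)
      also have "\<dots> = b i"
        using bk[of i] by (simp add: BS i)
      finally show ?thesis by (simp add: x_def)
    next
      case False
      \<comment> \<open>Above \<open>P\<close> the digits of \<open>b\<close> vanish by convention;
        those of \<open>floor_digit\<close> vanish because \<open>B 0 = 0\<close> bounds
        \<open>x\<close> by the weight of place \<open>P + 1\<close>.\<close>
      have x: "0 \<le> x" by (rule sums_le[OF _ sums_zero sums]) simp
      have "real k powi (- i) \<le> real k powi (- int P - 1)"
        using False k1 by (intro power_int_increasing) auto
      then have "x * real k powi (- i) \<le> x * real k powi (- int P - 1)"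
        using x by (rule mult_left_mono)
      moreover have "x * real k powi (- int P - 1) < 1"
        using floor[of 0] by (simp add: B0 floor_eq_iff)
      ultimately have "\<lfloor>x * real k powi (- i)\<rfloor> = 0"
        using x k1 by (simp add: floor_eq_iff)
      then show ?thesis
        using False by (simp add: floor_digit_def b0 x_def)
    qed
  qed
qed

lemma expansion_digit_eq:
  assumes "k \<ge> 2" "t > 0" "repeating_fractional k t"
  shows "expansion_digit k t = floor_digit k (of_rat t)"
  unfolding expansion_digit_def
  using base_expansion_floor_digit[OF assms] base_expansion_unique[OF assms(1,3)]
  by (intro the_equality) blast+

section \<open>Long division and the repetend\<close>

text \<open>The quotient side of a long division step: \<open>n * k ^ j div s\<close> is the integer
  part of \<open>n/s\<close> shifted by \<open>j\<close> places, so the next digit appended is that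
  of place \<open>- j - 1\<close>.\<close>

lemma floor_digit_fraction:
  assumes "k \<ge> 2" "s > 0"
  shows "n * k ^ Suc j div s = k * (n * k ^ j div s) + floor_digit k (real n / real s) (- int j - 1)"
proof -
  have fl: "\<lfloor>real n / real s * real k powi int i\<rfloor> = int (n * k ^ i div s)" for i
    using floor_divide_of_nat_eq[of "n * k ^ i" s] by simp
  have "int (n * k ^ Suc j div s) =
      int k * int (n * k ^ j div s) + int (floor_digit k (real n / real s) (- int j - 1))"
    using floor_shift[OF assms(1), of "real n / real s" "- int j - 1"] fl[of j] fl[of "Suc j"]
    by (simp add: add.commute)
  then show ?thesis by (metis of_nat_add of_nat_eq_iff of_nat_mult)
qed

text \<open>The remainder side of the same step, stated over the integers so that two instances can
  be subtracted.\<close>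

lemma remainder_step:
  assumes "k \<ge> 2" "s > 0"
  shows "int k * int (n * k ^ j mod s) =
         int (n * k ^ Suc j mod s) + int s * int (floor_digit k (real n / real s) (- int j - 1))"
proof -
  have "n * k ^ Suc j = s * (n * k ^ Suc j div s) + n * k ^ Suc j mod s"
       "n * k ^ j = s * (n * k ^ j div s) + n * k ^ j mod s"
    by simp_all
  then have "k * (s * (n * k ^ j div s) + n * k ^ j mod s) =
      s * (k * (n * k ^ j div s) + floor_digit k (real n / real s) (- int j - 1)) + n * k ^ Suc j mod s"
    by (metis floor_digit_fraction[OF assms] mult.left_commute power_Suc)
  then have "k * (n * k ^ j mod s) =
      n * k ^ Suc j mod s + s * floor_digit k (real n / real s) (- int j - 1)"
    unfolding distrib_left mult.left_commute[of k s] by linarith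
  then show ?thesis by (metis of_nat_add of_nat_mult)
qed

text \<open>Pigeonhole: the remainders lie below \<open>s\<close>, so two coincide, and from there
  on all later remainders and digits coincide. This makes the \<open>LEAST\<close> in
  \<open>preperiod_length\<close> meaningful.\<close>

lemma floor_digit_eventually_periodic:
  assumes "k \<ge> 2" "s > 0"
  shows "\<exists>\<rho> T. periodic_after (floor_digit k (real n / real s)) \<rho> T"
proof -
  have "\<not> inj (\<lambda>j::nat. n * k ^ j mod s)"
  proof
    assume "inj (\<lambda>j::nat. n * k ^ j mod s)"
    moreover have "range (\<lambda>j::nat. n * k ^ j mod s) \<subseteq> {..<s}" using assms by auto
    ultimately show False
      by (meson finite_imageD finite_lessThan finite_subset infinite_UNIV_nat)
  qed
  then obtain i j where ij: "i < j" "n * k ^ i mod s = n * k ^ j mod s"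
    unfolding inj_on_def by (metis nat_neq_iff)
  have rem: "n * k ^ (i + e) mod s = n * k ^ (j + e) mod s" for e
    using ij(2) by (simp add: power_add) (metis mod_mult_left_eq mult.assoc)
  \<comment> \<open>By \<open>remainder_step\<close>, two consecutive remainders determine the digit
    between them, as \<open>s\<close> is nonzero.\<close>
  have dig: "floor_digit k (real n / real s) (- int (i + e) - 1) =
             floor_digit k (real n / real s) (- int (j + e) - 1)" for e
    using remainder_step[OF assms, of n "i + e"] remainder_step[OF assms, of n "j + e"]
      rem[of e] rem[of "Suc e"] assms(2) by simp
  have "periodic_after (floor_digit k (real n / real s)) i (j - i)"
    unfolding periodic_after_def
  proof (intro conjI allI impI)
    show "1 \<le> j - i" using ij by simp
    fix z assume z: "z \<le> - int i - 1"
    define e where "e = nat (- z - 1 - int i)"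
    have "z = - int (i + e) - 1" "z - int (j - i) = - int (j + e) - 1"
      using z ij by (simp_all add: e_def of_nat_diff)
    then show "floor_digit k (real n / real s) (z - int (j - i)) = floor_digit k (real n / real s) z"
      using dig[of e] by presburger
  qed
  then show ?thesis by blast
qed

text \<open>Equal digits multiply the difference of the remainders by \<open>k\<close> at each step, but it stays below \<open>s\<close>.\<close>
lemma periodic_remainder:
  assumes "k \<ge> 2" "s > 0" and per: "periodic_after (floor_digit k (real n / real s)) \<rho> T"
  shows "n * k ^ (\<rho> + T) mod s = n * k ^ \<rho> mod s"
proof -
  define D where "D e = int (n * k ^ (\<rho> + T + e) mod s) - int (n * k ^ (\<rho> + e) mod s)" for e
  have step: "D (Suc e) = int k * D e" for e
  proof -
    have "floor_digit k (real n / real s) (- int (\<rho> + T + e) - 1) =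
          floor_digit k (real n / real s) (- int (\<rho> + e) - 1)"
      using per[unfolded periodic_after_def, THEN conjunct2, rule_format, of "- int (\<rho> + e) - 1"]
      by (simp add: diff_diff_eq add_ac)
    then show ?thesis
      using remainder_step[OF assms(1,2), of n "\<rho> + T + e"] remainder_step[OF assms(1,2), of n "\<rho> + e"]
      unfolding D_def right_diff_distrib add_Suc_right by simp
  qed
  have pow: "D e = int k ^ e * D 0" for e
    by (induction e) (simp_all add: step)
  have "D 0 = 0"
  proof (rule ccontr)
    assume "D 0 \<noteq> 0"
    \<comment> \<open>The index \<open>s\<close> is large enough: \<open>k ^ s\<close> exceeds
      \<open>s\<close>, while a difference of two remainders stays below \<open>s\<close> in
      absolute value.\<close>
    then have "int k ^ s \<le> \<bar>D s\<bar>"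
      using mult_left_mono[of 1 "\<bar>D 0\<bar>" "int k ^ s"] unfolding pow[of s] abs_mult by simp
    moreover have "int s < int k ^ s"
    proof -
      have "s < k ^ s" using assms(1) by (intro power_gt_expt) simp
      then show ?thesis by (simp flip: of_nat_power)
    qed
    moreover have "\<bar>D s\<bar> < int s"
    proof -
      have "n * k ^ (\<rho> + T + s) mod s < s" "n * k ^ (\<rho> + s) mod s < s" using assms(2) by simp_all
      then show ?thesis unfolding D_def by linarith
    qed
    ultimately show False by linarith
  qed
  then show ?thesis by (simp add: D_def)
qed

text \<open>Long division iterated \<open>T\<close> times; the sum has the shape of
  \<open>repetend\<close>, for an arbitrary starting place and block length.\<close>

lemma quotient_shift:
  assumes "k \<ge> 2" "s > 0"
  shows "n * k ^ (\<rho> + T) div s = k ^ T * (n * k ^ \<rho> div s) +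
         (\<Sum>m<T. floor_digit k (real n / real s) (- int \<rho> - 1 - int m) * k ^ (T - 1 - m))"
proof (induction T)
  case (Suc T)
  let ?a = "\<lambda>m. floor_digit k (real n / real s) (- int \<rho> - 1 - int m)"
  have "(\<Sum>m<T. ?a m * k ^ (T - m)) = k * (\<Sum>m<T. ?a m * k ^ (T - 1 - m))"
    unfolding sum_distrib_left
  proof (intro sum.cong refl)
    fix m assume "m \<in> {..<T}"
    then have "T - m = Suc (T - 1 - m)" by auto
    then show "?a m * k ^ (T - m) = k * (?a m * k ^ (T - 1 - m))" by simp
  qed
  moreover have "n * k ^ (\<rho> + Suc T) div s = k * (n * k ^ (\<rho> + T) div s) + ?a T"
  proof -
    have e: "- int \<rho> - 1 - int T = - int (\<rho> + T) - 1" by simp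
    show ?thesis unfolding e add_Suc_right by (rule floor_digit_fraction[OF assms])
  qed
  ultimately show ?case
    by (simp add: Suc distrib_left mult.assoc)
qed simp

text \<open>Equal remainders at \<rho> and \<rho> + \<open>T\<close> cancel when the two divisions
  are compared. The identity is arranged with sums on both sides to avoid subtraction on the
  naturals.\<close>

lemma repetend_identity:
  assumes "k \<ge> 2" "n > 0" "s > 0" and rep: "repeating_fractional k (of_nat n / of_nat s)"
  obtains \<rho> T where
    "n * k ^ (\<rho> + T) + s * (n * k ^ \<rho> div s) =
     n * k ^ \<rho> + s * (k ^ T * (n * k ^ \<rho> div s) + repetend k (of_nat n / of_nat s))"
proof -
  let ?t = "of_nat n / of_nat s :: rat"
  define \<rho> where "\<rho> = preperiod_length k ?t"
  define T where "T = period_length k ?t"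
  have dig: "expansion_digit k ?t = floor_digit k (real n / real s)"
    using expansion_digit_eq[OF assms(1) _ rep] assms by (simp add: of_rat_divide)
  \<comment> \<open>The two nested minima are resolved in turn: first the preperiod is attained,
    then the period belonging to it.\<close>
  have "\<exists>T. periodic_after (floor_digit k (real n / real s)) \<rho> T"
    unfolding \<rho>_def preperiod_length_def dig
    using floor_digit_eventually_periodic[OF assms(1,3)] by (rule LeastI_ex)
  then have "periodic_after (floor_digit k (real n / real s)) \<rho> T"
    unfolding T_def period_length_def dig \<rho>_def[symmetric] by (rule LeastI_ex)
  then have "n * k ^ (\<rho> + T) mod s = n * k ^ \<rho> mod s"
    by (rule periodic_remainder[OF assms(1,3)])
  then have "n * k ^ (\<rho> + T) = s * (n * k ^ (\<rho> + T) div s) + n * k ^ \<rho> mod s"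
    by (metis mult_div_mod_eq)
  moreover have "n * k ^ (\<rho> + T) div s = k ^ T * (n * k ^ \<rho> div s) + repetend k ?t"
    using quotient_shift[OF assms(1,3)] by (simp add: repetend_def dig \<rho>_def T_def)
  moreover have "n * k ^ \<rho> = s * (n * k ^ \<rho> div s) + n * k ^ \<rho> mod s" by simp
  ultimately show ?thesis
    by (intro that[of \<rho> T]) (simp only: add_ac)
qed

text \<open>Modulo \<open>k - 1\<close> every power of \<open>k\<close> becomes 1, so the identity
  collapses to \<open>n + s * A\<close> being congruent to \<open>n + s * A + s * ?R\<close>; then
  \<open>s\<close> cancels by coprimality.\<close>

lemma repetend_cong_0:
  assumes "k \<ge> 2" "n > 0" "s > 0" "repeating_fractional k (of_nat n / of_nat s)"
    and "coprime s (k - 1)"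
  shows "[repetend k (of_nat n / of_nat s) = 0] (mod (k - 1))"
proof -
  let ?R = "repetend k (of_nat n / of_nat s)"
  obtain \<rho> T where eq: "n * k ^ (\<rho> + T) + s * (n * k ^ \<rho> div s) =
     n * k ^ \<rho> + s * (k ^ T * (n * k ^ \<rho> div s) + ?R)"
    using repetend_identity[OF assms(1-4)] .
  define A where "A = n * k ^ \<rho> div s"
  have pow: "[k ^ e = 1] (mod (k - 1))" for e
    using cong_pow[OF cong_base_1[of k], of e] assms(1) by simp
  have "[n * k ^ (\<rho> + T) + s * A = n * 1 + s * A] (mod (k - 1))"
    by (intro cong_add cong_mult cong_refl pow)
  moreover have "[n * k ^ \<rho> + s * (k ^ T * A + ?R) = n * 1 + s * (1 * A + ?R)] (mod (k - 1))"
    by (intro cong_add cong_mult cong_refl pow)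
  ultimately have "[n * 1 + s * A = n * 1 + s * (1 * A + ?R)] (mod (k - 1))"
    using eq unfolding A_def[symmetric] by (metis cong_sym cong_trans)
  then have "[(n + s * A) + s * ?R = (n + s * A) + s * 0] (mod (k - 1))"
    by (simp add: algebra_simps cong_sym_eq)
  then have "[s * ?R = s * 0] (mod (k - 1))"
    by (simp only: cong_add_lcancel_nat)
  then show ?thesis
    using assms(5) by (simp only: cong_mult_lcancel_nat)
qed

text \<open>If the fraction terminated, \<open>s\<close> would divide a power of \<open>k\<close>
  times \<open>n\<close>, hence that power alone; then so would \<open>p\<close>, which is coprime
  to \<open>k\<close> and not a unit.\<close>

lemma repeating_fractional_fraction:
  fixes n s p k :: nat
  assumes "s > 0" "coprime n s" "p dvd s" "p \<ge> 2" "coprime p k"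
  shows "repeating_fractional k (of_nat n / of_nat s)"
  unfolding repeating_fractional_def terminating_fractional_def
proof
  assume "\<exists>\<rho>. of_nat k ^ \<rho> * (of_nat n / of_nat s :: rat) \<in> \<int>"
  then obtain \<rho> z where "of_nat k ^ \<rho> * (of_nat n / of_nat s :: rat) = of_int z"
    by (auto elim: Ints_cases)
  then have "(of_int (int k ^ \<rho> * int n) :: rat) = of_int (z * int s)"
    using assms(1) by (simp add: field_simps)
  then have "int (k ^ \<rho> * n) = z * int s"
    by (simp only: of_int_eq_iff) simp
  then have "s dvd k ^ \<rho> * n"
    by (metis dvd_triv_right int_dvd_int_iff)
  then have "s dvd k ^ \<rho>"
    using assms(2) by (simp add: coprime_dvd_mult_left_iff coprime_commute)
  then have "p dvd k ^ \<rho>"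
    using assms(3) dvd_trans by blast
  moreover have "coprime p (k ^ \<rho>)" using assms(5) by simp
  ultimately have "is_unit p" by (metis coprime_absorb_left)
  then show False using assms(4) by simp
qed

theorem theorem4p1:
  fixes k n s p :: nat and l :: "nat \<Rightarrow> nat"
  assumes "k \<ge> 2"
    and "n \<ge> 1" and "s \<ge> 2"
    and "gcd n s = 1"
    and "s = (\<Prod>q\<in>prime_factors k. q ^ l q) * p"
    and "p \<ge> 2"
    and "gcd p (k - 1) = 1" and "gcd p k = 1"
  shows "repeating_fractional k (of_nat n / of_nat s) \<and>
         [digital_root k (repetend k (of_nat n / of_nat s)) = 0] (mod (k - 1))"
proof
  show rep: "repeating_fractional k (of_nat n / of_nat s)"
  proof (rule repeating_fractional_fraction[where p = p])
    show "s > 0" using assms(3) by simp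
    show "p dvd s" using assms(5) by simp
  qed (use assms(4,6,8) in \<open>simp_all only: coprime_iff_gcd_eq_1\<close>)
  \<comment> \<open>Each prime factor of \<open>k\<close> inherits coprimality to
    \<open>k - 1\<close> from \<open>k\<close>; together with the hypothesis on \<open>p\<close>
    this makes \<open>s\<close> coprime to \<open>k - 1\<close>.\<close>
  have "coprime k (k - 1)"
    using assms(1) coprime_diff_one_right_nat[of k] by simp
  then have "coprime (q ^ l q) (k - 1)" if "q \<in> prime_factors k" for q
    using that by (meson coprime_divisors coprime_power_left_iff dvd_refl in_prime_factors_imp_dvd)
  then have "coprime (\<Prod>q\<in>prime_factors k. q ^ l q) (k - 1)"
    by (rule prod_coprime_left)
  then have "coprime s (k - 1)"
    unfolding assms(5) coprime_mult_left_iff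
    using assms(7) by (simp only: coprime_iff_gcd_eq_1)
  then have "[repetend k (of_nat n / of_nat s) = 0] (mod (k - 1))"
    using assms(1-3) by (intro repetend_cong_0 rep) simp_all
  then show "[digital_root k (repetend k (of_nat n / of_nat s)) = 0] (mod (k - 1))"
    using digital_root_cong[OF assms(1)] cong_trans by blast
qed

end
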